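(* Let $k$ be a fixed nonnegative integer. For $n\ge k$ let $A_k$ be the set of all binary strings of length $n$ with exactly $k$ ones (the encodings of the $k$-subsets of $[n]=\{1,\dots,n\}$). There exists a universal covering for $A_k$ of length $(1+o(1))\binom{n}{k}$ as $n\to\infty$.
   Context: A subset $B\subseteq[n]$ is encoded by the binary string $a_1\cdots a_n$ with $a_i=1$ if $i\in B$ and $a_i=0$ otherwise. A universal covering for a set $A_k$ of binary strings of length $n$ is a cyclic binary sequence $c_0c_1\cdots c_{L-1}$ (of length $L$) such that every string of $A_k$ occurs at least once among the windows $c_ic_{i+1}\cdots c_{i+n-1}$, $0\le i<L$ (indices modulo $L$). The assertion means: for each $n\ge k$ there is a universal covering $U_n$ of $A_k$ with $|U_n|/\binom{n}{k}\to 1$ as $n\to\infty$. *)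

theory Defs
  imports Complex_Main
begin

text \<open>Binary strings are lists over \<^typ>\<open>bool\<close>, with True for 1 and False for 0.\<close>

definition encode_subset :: "nat \<Rightarrow> nat set \<Rightarrow> bool list" where
  "encode_subset n B = map (\<lambda>i. i \<in> B) [1..<Suc n]"

definition weight_strings :: "nat \<Rightarrow> nat \<Rightarrow> bool list set" where
  "weight_strings n k = {w. length w = n \<and> count_list w True = k}"

lemma weight_strings_eq_encode:
  "weight_strings n k = encode_subset n ` {B. B \<subseteq> {1..n} \<and> card B = k}"
proof -
  have cnt: "count_list (encode_subset n B) True = card B" if "B \<subseteq> {1..n}" for B
  proof -
    have "count_list (encode_subset n B) True = length (filter (\<lambda>i. i \<in> B) [1..<Suc n])"
      unfolding encode_subset_def count_list_eq_length_filter
      by (simp only: filter_map length_map o_def eq_True simp_thms)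
    also have "\<dots> = card (set (filter (\<lambda>i. i \<in> B) [1..<Suc n]))"
      by (rule distinct_card [symmetric]) simp
    also have "set (filter (\<lambda>i. i \<in> B) [1..<Suc n]) = B"
      using that by auto
    finally show ?thesis .
  qed
  have surj: "\<exists>B \<subseteq> {1..n}. w = encode_subset n B" if "length w = n" for w
  proof (intro exI conjI)
    let ?B = "{i \<in> {1..n}. w ! (i - 1)}"
    show "?B \<subseteq> {1..n}" by auto
    show "w = encode_subset n ?B"
      using that by (intro nth_equalityI) (auto simp: encode_subset_def simp del: upt_Suc)
  qed
  have len: "length (encode_subset n B) = n" for B
    by (simp add: encode_subset_def)
  show ?thesis
  proof (intro equalityI subsetI)
    fix w assume w: "w \<in> weight_strings n k"
    then obtain B where B: "B \<subseteq> {1..n}" "w = encode_subset n B"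
      using surj [of w] by (auto simp only: weight_strings_def mem_Collect_eq)
    with w cnt [OF B(1)] show "w \<in> encode_subset n ` {B. B \<subseteq> {1..n} \<and> card B = k}"
      by (auto simp only: weight_strings_def mem_Collect_eq)
  next
    fix w assume "w \<in> encode_subset n ` {B. B \<subseteq> {1..n} \<and> card B = k}"
    then show "w \<in> weight_strings n k"
      using cnt len by (auto simp only: weight_strings_def mem_Collect_eq)
  qed
qed

text \<open>
  A cyclic sequence is represented by a list \<open>c\<close> whose indices are read modulo its length \<open>L\<close>.
  A window may be longer than \<open>L\<close>, in which case it wraps around several times. For instance, the
  single symbol 0, as a cyclic sequence of length 1, covers the all-zero string of every length.
\<close>

definition cyclic_window :: "'a list \<Rightarrow> nat \<Rightarrow> nat \<Rightarrow> 'a list" where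
  "cyclic_window c n i = map (\<lambda>j. c ! ((i + j) mod length c)) [0..<n]"

definition universal_covering :: "nat \<Rightarrow> bool list set \<Rightarrow> bool list \<Rightarrow> bool" where
  "universal_covering n A c \<longleftrightarrow> (\<forall>w\<in>A. \<exists>i<length c. cyclic_window c n i = w)"

end

theory Submission
  imports Defs "Graph_Theory.Euler" "HOL-Real_Asymp.Real_Asymp"
begin

text \<open>
  Sliding a window without changing its weight can only rotate it, so windows of weight \<open>k\<close>
  alone do not lead from one rotation class to another. Instead cover the strings of weight
  \<open>k - 1\<close> and those of weight \<open>k\<close> together (for \<open>k \<ge> 1\<close>), each exactly once. For fixed \<open>k\<close>
  the extra strings are negligible: together there are \<open>n + 1 choose k\<close> of them, which is
  \<open>(n + 1) / (n + 1 - k)\<close> times \<open>n choose k\<close>. For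
  \<open>k = 0\<close> the cyclic sequence with the single letter 0 will do.

  Such a covering is an Eulerian circuit in the de Bruijn digraph whose arcs are the given
  strings, each leading from its prefix to its suffix of length \<open>n - 1\<close>. Closure under rotation
  makes the digraph balanced, because \<open>x # u \<mapsto> u @ [x]\<close> pairs the arcs into \<open>u\<close> with the arcs
  out of \<open>u\<close>; moreover, the rotations of one string form a closed walk. One vertex on this
  walk consists of all letters but the one at position \<open>i\<close>, so the closed walks of two
  strings that differ in one place meet. With two adjacent weights at hand, any string can be
  turned into any other one letter at a time, so the digraph is strongly connected and
  Euler's theorem (\<open>fin_digraph.closed_euler1\<close>) applies.
\<close>

section \<open>Cyclic sequences from rotation-closed sets of strings\<close>

text \<open>
  The digraph is meant for sets \<open>S\<close> of nonempty strings closed under rotation, for which every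
  prefix \<open>butlast w\<close> is also a suffix, namely that of the string that rotates to \<open>w\<close>; hence the
  suffixes alone are all the vertices.
\<close>

definition de_bruijn_digraph :: "'a list set \<Rightarrow> ('a list, 'a list) pre_digraph" where
  "de_bruijn_digraph S = \<lparr>verts = tl ` S, arcs = S, tail = butlast, head = tl\<rparr>"

definition letter_changes :: "'a list set \<Rightarrow> ('a list \<times> 'a list) set" where
  "letter_changes S = {(w, w[i := a]) | w i a. i < length w \<and> w \<in> S \<and> w[i := a] \<in> S}"

text \<open>
  Rotating by \<open>i\<close> moves the changed letter to the front, where \<open>tl\<close> removes it. This is the vertex
  at which the closed walks of two strings that differ only in letter \<open>i\<close> meet.
\<close>

lemma tl_rotate_list_update:
  assumes "i < length w"
  shows "tl (rotate i (w[i := a])) = tl (rotate i w)"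
  using assms by (simp add: rotate_drop_take drop_update_swap upd_conv_take_nth_drop
      Cons_nth_drop_Suc [symmetric] del: Cons_nth_drop_Suc)

lemma butlast_rotate1:
  assumes "w \<noteq> []"
  shows "butlast (rotate1 w) = tl w"
  using assms by (cases w) auto

lemma (in pre_digraph) cas_nth_Suc:
  assumes "cas u p v" "Suc i < length p"
  shows "tail G (p ! Suc i) = head G (p ! i)"
  using assms
proof (induction p arbitrary: u i)
  case (Cons e p)
  then show ?case by (cases i; cases p) auto
qed simp

lemma (in pre_digraph) cas_end_vertices:
  assumes "cas u p v" "p \<noteq> []"
  shows "tail G (p ! 0) = u" "head G (p ! (length p - 1)) = v"
proof -
  show "tail G (p ! 0) = u" using assms by (cases p) auto
  show "head G (p ! (length p - 1)) = v" using assms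
    by (induction p arbitrary: u) (auto simp: nth_Cons' split: if_splits)
qed

text \<open>
  The first letters along a closed walk spell its arcs: each step drops one letter in front, so
  the letter \<open>j\<close> of an arc has moved to the front \<open>j\<close> steps later.
\<close>

lemma cyclic_window_map_hd:
  assumes len: "\<And>i. i < length p \<Longrightarrow> length (p ! i) = n"
    and step: "\<And>i. i < length p \<Longrightarrow> butlast (p ! (Suc i mod length p)) = tl (p ! i)"
    and i: "i < length p" and n: "0 < n"
  shows "cyclic_window (map hd p) n i = p ! i"
proof -
  let ?L = "length p"
  have L: "0 < ?L" using i by auto
  have "p ! i ! j = hd (p ! ((i + j) mod ?L))" if "j < n" "i < ?L" for i j
    using that
  proof (induction j arbitrary: i)
    case 0
    then show ?case using len [of i] n by (auto simp: hd_conv_nth)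
  next
    case (Suc j)
    have i': "Suc i mod ?L < ?L" using L by simp
    have "p ! i ! Suc j = tl (p ! i) ! j"
      using Suc.prems len [of i] by (simp add: nth_tl)
    also have "\<dots> = butlast (p ! (Suc i mod ?L)) ! j"
      using step [of i] Suc.prems by simp
    also have "\<dots> = p ! (Suc i mod ?L) ! j"
      using Suc.prems len [OF i'] by (simp add: nth_butlast)
    also have "\<dots> = hd (p ! ((Suc i mod ?L + j) mod ?L))"
      using Suc.IH [OF _ i'] Suc.prems by simp
    also have "(Suc i mod ?L + j) mod ?L = (i + Suc j) mod ?L"
      by (simp add: mod_simps)
    finally show ?case .
  qed
  then show ?thesis
    using i len [of i] L by (intro nth_equalityI) (auto simp: cyclic_window_def)
qed

text \<open>
  Rotations keep the digraph balanced, and letter changes join the closed walks of different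
  rotation classes, so the first letters along an Eulerian circuit form the required sequence.
\<close>

theorem ex_de_bruijn_cycle:
  fixes S :: "'a list set"
  assumes fin: "finite S" and ne: "S \<noteq> {}" and n: "0 < n"
    and len: "\<And>w. w \<in> S \<Longrightarrow> length w = n"
    and rot: "\<And>w. w \<in> S \<Longrightarrow> rotate1 w \<in> S"
    and conn: "\<And>w w'. w \<in> S \<Longrightarrow> w' \<in> S \<Longrightarrow> (w, w') \<in> (letter_changes S)\<^sup>*"
  shows "\<exists>c. length c = card S \<and> (\<forall>w\<in>S. \<exists>i<length c. cyclic_window c n i = w)"
proof -
  define G where "G = de_bruijn_digraph S"
  have G [simp]: "verts G = tl ` S" "arcs G = S" "tail G = butlast" "head G = tl"
    by (simp_all add: G_def de_bruijn_digraph_def)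
  have rotm: "rotate m w \<in> S" if "w \<in> S" for m w
    using that rot by (induction m) auto
  have unrot: "\<exists>v\<in>S. w = rotate1 v" if "w \<in> S" for w
  proof
    show "rotate (n - 1) w \<in> S" using that by (rule rotm)
    have "rotate1 (rotate (n - 1) w) = rotate n w"
      using n rotate_Suc [of "n - 1" w] by simp
    then show "w = rotate1 (rotate (n - 1) w)" using len [OF that] by simp
  qed
  have nonempty: "w \<noteq> []" if "w \<in> S" for w using len [OF that] n by auto
  have tail_vert: "butlast w \<in> tl ` S" if "w \<in> S" for w
    using unrot [OF that] nonempty by (auto simp: butlast_rotate1)
  interpret fin_digraph G
    by unfold_locales (use fin tail_vert in auto)
  have walk: "tl w \<rightarrow>\<^sup>*\<^bsub>G\<^esub> tl (rotate m w)" if "w \<in> S" for w m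
  proof (induction m)
    case 0
    show ?case using that by (auto intro: reachable_refl)
  next
    case (Suc m)
    have mem: "rotate (Suc m) w \<in> S" using that by (rule rotm)
    have "butlast (rotate (Suc m) w) = tl (rotate m w)"
      using nonempty [OF that] by (simp add: butlast_rotate1)
    then have "tl (rotate m w) \<rightarrow>\<^bsub>G\<^esub> tl (rotate (Suc m) w)"
      using in_arcs_imp_in_arcs_ends [of "rotate (Suc m) w"] mem by simp
    then show ?case using Suc.IH by (meson reachable_adj_trans)
  qed
  (* n - m further rotations complete the closed walk of w *)
  have walk_back: "tl (rotate m w) \<rightarrow>\<^sup>*\<^bsub>G\<^esub> tl w" if "w \<in> S" "m < n" for w m
  proof -
    have "rotate (n - m) (rotate m w) = w"
      using that len [of w] by (simp add: rotate_rotate)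
    then show ?thesis using walk [OF rotm [OF that(1), of m], of "n - m"] by simp
  qed
  have change: "tl w \<rightarrow>\<^sup>*\<^bsub>G\<^esub> tl w'" if "(w, w') \<in> letter_changes S" for w w'
  proof -
    obtain i a where i: "i < length w" "w \<in> S" "w' \<in> S" "w' = w[i := a]"
      using \<open>(w, w') \<in> letter_changes S\<close> by (auto simp: letter_changes_def)
    have "tl (rotate i w) = tl (rotate i w')"
      using i by (simp add: tl_rotate_list_update)
    then show ?thesis
      using walk [OF i(2), of i] walk_back [OF i(3), of i] i(1) len [OF i(2)]
      by (metis reachable_trans)
  qed
  have reach: "tl w \<rightarrow>\<^sup>*\<^bsub>G\<^esub> tl w'" if "(w, w') \<in> (letter_changes S)\<^sup>*" "w \<in> S" for w w'
    using that
  proof (induction rule: rtrancl_induct)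
    case base
    then show ?case by (auto intro: reachable_refl)
  next
    case (step y z)
    then show ?case using change reachable_trans by blast
  qed
  have "u \<rightarrow>\<^sup>*\<^bsub>G\<^esub> v" if "u \<in> verts G" "v \<in> verts G" for u v
    using that reach conn by auto
  then have "connected G"
    using ne reachable_mk_symmetricI by (auto simp: connected_def strongly_connected_def)
  moreover have "in_degree G u = out_degree G u" if "u \<in> verts G" for u
  proof -
    have "bij_betw rotate1 (in_arcs G u) (out_arcs G u)"
    proof (rule bij_betw_imageI)
      show "inj_on rotate1 (in_arcs G u)"
        by (rule inj_onI) (auto simp: list.expand rotate1_hd_tl dest!: nonempty)
      have "w \<in> rotate1 ` in_arcs G u" if "w \<in> out_arcs G u" for w
        using that unrot [of w] nonempty by (auto simp: butlast_rotate1)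
      then show "rotate1 ` in_arcs G u = out_arcs G u"
        using rot nonempty by (auto simp: butlast_rotate1)
    qed
    then show ?thesis
      unfolding in_degree_def out_degree_def by (rule bij_betw_same_card)
  qed
  ultimately obtain u p where "euler_trail u p u"
    using closed_euler1 by blast
  then have p: "cas u p u" "distinct p" "set p = S"
    by (auto simp: euler_trail_def trail_def awalk_def)
  have p_ne: "p \<noteq> []" using p ne by auto
  have step: "butlast (p ! (Suc i mod length p)) = tl (p ! i)" if "i < length p" for i
  proof (cases "Suc i < length p")
    case True
    then show ?thesis using cas_nth_Suc [OF p(1) True] by simp
  next
    case False
    then have "Suc i = length p" using that by simp
    then show ?thesis using cas_end_vertices [OF p(1) p_ne]
      by (metis G(3,4) diff_Suc_1 mod_self)
  qed
  have window: "cyclic_window (map hd p) n i = p ! i" if "i < length p" for i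
    using that n step p(3) len by (intro cyclic_window_map_hd) auto
  have "length (map hd p) = card S"
    using p distinct_card by fastforce
  moreover have "\<exists>i<length (map hd p). cyclic_window (map hd p) n i = w" if "w \<in> S" for w
    using that p(3) window by (metis in_set_conv_nth length_map)
  ultimately show ?thesis by blast
qed

section \<open>Strings of two adjacent weights\<close>

lemma count_list_True_conv_card: "count_list w True = card {i. i < length w \<and> w ! i}"
  by (simp add: count_list_eq_length_filter length_filter_conv_card)

lemma finite_weight_strings: "finite (weight_strings n k)"
  by (simp add: weight_strings_eq_encode)

lemma card_weight_strings: "card (weight_strings n k) = n choose k"
proof -
  have "inj_on (encode_subset n) {B. B \<subseteq> {1..n} \<and> card B = k}"
    by (rule inj_onI) (auto simp: encode_subset_def simp del: upt_Suc)
  then show ?thesis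
    by (simp add: weight_strings_eq_encode card_image n_subsets)
qed

lemma count_list_rotate1: "count_list (rotate1 w) x = count_list w x"
  by (cases w) auto

text \<open>
  Induction on the number of places where the two strings disagree. If the first one has the
  larger weight, then one of its ones is a zero of the other (or the two strings agree), and
  deleting it stays within the two weights; if it has the smaller weight, a one can be added.
\<close>

lemma letter_changes_weight_strings_connected:
  fixes n j :: nat
  defines "S \<equiv> weight_strings n j \<union> weight_strings n (Suc j)"
  assumes "w \<in> S" "w' \<in> S"
  shows "(w, w') \<in> (letter_changes S)\<^sup>*"
  using assms(2)
proof (induction "card {i. i < n \<and> w ! i \<noteq> w' ! i}" arbitrary: w rule: less_induct)
  case less
  let ?T = "\<lambda>v. {i. i < n \<and> v ! i}"
  have mem: "v \<in> S \<longleftrightarrow> length v = n \<and> (card (?T v) = j \<or> card (?T v) = Suc j)" for v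
    by (auto simp: S_def weight_strings_def count_list_True_conv_card)
  have w: "length w = n" "card (?T w) = j \<or> card (?T w) = Suc j"
    using less.prems by (auto simp: mem)
  have w': "length w' = n" "card (?T w') = j \<or> card (?T w') = Suc j"
    using \<open>w' \<in> S\<close> by (auto simp: mem)
  have change: ?case if i: "i < n" "w ! i \<noteq> w' ! i" and S: "w[i := w' ! i] \<in> S" for i
  proof -
    let ?v = "w[i := w' ! i]"
    have "{l. l < n \<and> ?v ! l \<noteq> w' ! l} \<subset> {l. l < n \<and> w ! l \<noteq> w' ! l}"
      using i w(1) by (auto simp: nth_list_update)
    then have "card {l. l < n \<and> ?v ! l \<noteq> w' ! l} < card {l. l < n \<and> w ! l \<noteq> w' ! l}"
      by (intro psubset_card_mono) auto
    then have "(?v, w') \<in> (letter_changes S)\<^sup>*" using less.hyps S by blast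
    moreover have "(w, ?v) \<in> letter_changes S"
      using i w(1) S less.prems by (auto simp: letter_changes_def)
    ultimately show ?thesis by (rule converse_rtrancl_into_rtrancl [rotated])
  qed
  have eqI: "w = w'" if "?T w = ?T w'"
    using that w(1) w'(1) by (intro nth_equalityI) auto
  show ?case
  proof (cases "card (?T w) = Suc j")
    case True
    show ?thesis
    proof (cases "?T w \<subseteq> ?T w'")
      case sub: True
      then have "?T w = ?T w'"
        using True w'(2) card_mono [OF _ sub] by (intro card_subset_eq) auto
      then show ?thesis using eqI by simp
    next
      case False
      then obtain i where i: "i < n" "w ! i" "\<not> w' ! i" by auto
      have "?T (w[i := w' ! i]) = ?T w - {i}"
        using i w(1) by (auto simp: nth_list_update)
      then have "card (?T (w[i := w' ! i])) = j" using True i by simp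
      then show ?thesis using change [of i] i w(1) by (auto simp: mem)
    qed
  next
    case False
    then have j: "card (?T w) = j" using w(2) by simp
    show ?thesis
    proof (cases "?T w' \<subseteq> ?T w")
      case sub: True
      then have "?T w' = ?T w"
        using j w'(2) card_mono [OF _ sub] by (intro card_subset_eq) auto
      then show ?thesis using eqI by simp
    next
      case False
      then obtain i where i: "i < n" "\<not> w ! i" "w' ! i" by auto
      have "?T (w[i := w' ! i]) = insert i (?T w)"
        using i w(1) by (auto simp: nth_list_update)
      then have "card (?T (w[i := w' ! i])) = Suc j" using j i by simp
      then show ?thesis using change [of i] i w(1) by (auto simp: mem)
    qed
  qed
qed

lemma ex_universal_covering_Suc:
  assumes "Suc j \<le> n"
  shows "\<exists>c. universal_covering n (weight_strings n (Suc j)) c \<and> length c = Suc n choose Suc j"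
proof -
  let ?S = "weight_strings n j \<union> weight_strings n (Suc j)"
  have card: "card ?S = Suc n choose Suc j"
  proof (subst card_Un_disjoint)
    show "weight_strings n j \<inter> weight_strings n (Suc j) = {}"
      by (auto simp: weight_strings_def)
  qed (simp_all add: finite_weight_strings card_weight_strings)
  have "\<exists>c. length c = card ?S \<and> (\<forall>w\<in>?S. \<exists>i<length c. cyclic_window c n i = w)"
  proof (rule ex_de_bruijn_cycle)
    have "card ?S \<noteq> 0" using assms card by simp
    then show "?S \<noteq> {}" by auto
    show "(w, w') \<in> (letter_changes ?S)\<^sup>*" if "w \<in> ?S" "w' \<in> ?S" for w w'
      using that by (rule letter_changes_weight_strings_connected)
  qed (use assms finite_weight_strings in \<open>auto simp: weight_strings_def count_list_rotate1\<close>)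
  then show ?thesis using card by (auto simp: universal_covering_def)
qed

lemma binomial_Suc_ratio_tendsto_1:
  "(\<lambda>n. real (Suc n choose Suc j) / real (n choose Suc j)) \<longlonglongrightarrow> 1"
proof (rule Lim_transform_eventually)
  show "(\<lambda>n. (real n + 1) / (real n - real j)) \<longlonglongrightarrow> 1" by real_asymp
  show "\<forall>\<^sub>F n in sequentially. (real n + 1) / (real n - real j)
      = real (Suc n choose Suc j) / real (n choose Suc j)"
    using eventually_gt_at_top [of j]
  proof eventually_elim
    case (elim n)
    have "(n - j) * (Suc n choose Suc j) = Suc n * (n choose Suc j)"
      using binomial_absorb_comp [of "Suc n" "Suc j"] by simp
    then have "real (n - j) * real (Suc n choose Suc j) = real (Suc n) * real (n choose Suc j)"
      by (simp only: of_nat_mult [symmetric])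
    moreover have "0 < n choose Suc j" using elim by simp
    ultimately show ?case using elim by (simp add: field_simps of_nat_diff del: binomial_Suc_Suc)
  qed
qed

theorem theorem4:
  fixes k :: nat
  shows "\<exists>U :: nat \<Rightarrow> bool list.
           (\<forall>n\<ge>k. universal_covering n (weight_strings n k) (U n)) \<and>
           (\<lambda>n. real (length (U n)) / real (n choose k)) \<longlonglongrightarrow> 1"
proof (cases k)
  case 0
  have "universal_covering n (weight_strings n 0) [False]" for n
    by (auto simp: universal_covering_def weight_strings_def cyclic_window_def count_list_0_iff
        intro!: nth_equalityI) (metis (full_types) nth_mem)
  then show ?thesis using 0 by (intro exI [of _ "\<lambda>_. [False]"]) simp
next
  case (Suc j)
  obtain U where U: "\<And>n. k \<le> n \<Longrightarrow>
      universal_covering n (weight_strings n k) (U n) \<and> length (U n) = Suc n choose Suc j"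
    using ex_universal_covering_Suc unfolding Suc by metis
  have "(\<lambda>n. real (length (U n)) / real (n choose k)) \<longlonglongrightarrow> 1"
  proof (rule Lim_transform_eventually [OF binomial_Suc_ratio_tendsto_1 [of j]])
    show "\<forall>\<^sub>F n in sequentially. real (Suc n choose Suc j) / real (n choose Suc j)
        = real (length (U n)) / real (n choose k)"
      using eventually_ge_at_top [of k] by eventually_elim (simp only: U Suc)
  qed
  then show ?thesis using U by blast
qed

end
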